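(* Let $D$ be a strongly connected digraph on the vertex set $[n]$ such that $\gcd\{c_1,\ldots,c_n\}=1$. Then $P_D$ is equivalent to the weighted projective space $\mathbb{P}(c_1,\ldots,c_n)$.
   Context: A digraph $D$ is a finite directed graph on the vertex set $[n]=\{1,\ldots,n\}$, without loops and without isolated vertices (vertices with indegree and outdegree both zero); multiple directed edges are allowed. A directed edge $(i,j)$ has tail $i$ and head $j$. $D$ is strongly connected if it contains a directed path from $i$ to $j$ for every pair of vertices $i,j$. Let $a_{i,j}$ be the number of edges with tail $i$ and head $j$ (so $a_{i,i}=0$), and let $\mathrm{outdeg}(i)=\sum_j a_{i,j}$. The Laplacian matrix of $D$ is $L(D)=O(D)-A(D)$, where $A(D)=(a_{i,j})$ and $O(D)$ is the diagonal matrix with entries $\mathrm{outdeg}(i)$. The Laplacian polytope of $D$ is $P_D=\operatorname{conv}\{\mathbf{v}_1,\ldots,\mathbf{v}_n\}\subset\mathbb{R}^n$, where $\mathbf{v}_i$ is the $i$-th row of $L(D)$. It lies in the hyperplane $H=\{\mathbf{x}\in\mathbb{R}^n:\sum_i x_i=0\}$, and is regarded as a lattice polytope with respect to the lattice $H\cap\mathbb{Z}^n$ of rank $n-1$. A converging tree is a digraph whose underlying undirected graph is connected and that has one vertex of outdegree zero (its root), all other vertices having outdegree one. A subgraph of $D$ is spanning if its vertex set is $[n]$. Let $c_i$ be the number of spanning converging trees of $D$ with root $i$ (parallel edges are regarded as distinct). For positive integers $\lambda_1,\ldots,\lambda_n$ with $\gcd\{\lambda_1,\ldots,\lambda_n\}=1$,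 the weighted projective space $\mathbb{P}(\lambda_1,\ldots,\lambda_n)=\mathrm{Proj}(\mathbb{C}[x_1,\ldots,x_n])$, with grading $\deg x_i=\lambda_i$, is a toric variety. Its fan is characterized, up to isomorphism, as follows: let $\mathbf{w}_1,\ldots,\mathbf{w}_n$ be primitive lattice points which generate the lattice (of rank $n-1$) and satisfy $\sum_{i=1}^n\lambda_i\mathbf{w}_i=\mathbf{0}$; the fan is the one whose rays are generated by the $\mathbf{w}_i$. This fan identifies the simplex $\operatorname{conv}\{\mathbf{w}_1,\ldots,\mathbf{w}_n\}$. A lattice simplex is said to be (equivalent to) the weighted projective space $\mathbb{P}(\lambda_1,\ldots,\lambda_n)$ if it is unimodularly equivalent to this simplex, i.e. if some affine isomorphism of the ambient lattices maps one simplex onto the other.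
   Formalization: Primitivity of the points w_i defining P(λ_1,…,λ_n) is required only when any n−1 of the weights are coprime; otherwise no primitive w_i exist (e.g. c=(1,3)), and the simplex is fixed by generating the lattice and Σλ_i w_i=0. *)

theory Defs
  imports
    "HOL-Analysis.Analysis"
    "HOL-Computational_Algebra.Group_Closure"
    "Graph_Theory.Digraph"
    "Graph_Theory.Digraph_Component"
begin

section \<open>Digraphs and Laplacian polytopes\<close>

text \<open>
  A digraph on $[n]$ is a \<open>('n, 'e) pre_digraph\<close> whose vertex set is the whole finite
  type \<open>'n\<close>, so that $n$ is \<open>CARD('n)\<close>.  Arcs are labelled by elements of \<open>'e\<close>; parallel arcs
  are therefore allowed and are distinct.
\<close>

definition adjacency_matrix :: "('n::finite, 'e) pre_digraph \<Rightarrow> real^'n^'n" where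
  "adjacency_matrix D = (\<chi> i j. real (card {e \<in> arcs D. tail D e = i \<and> head D e = j}))"

definition outdegree_matrix :: "('n::finite, 'e) pre_digraph \<Rightarrow> real^'n^'n" where
  "outdegree_matrix D = (\<chi> i j. if i = j then real (out_degree D i) else 0)"

definition laplacian :: "('n::finite, 'e) pre_digraph \<Rightarrow> real^'n^'n" where
  "laplacian D = outdegree_matrix D - adjacency_matrix D"

definition laplacian_polytope :: "('n::finite, 'e) pre_digraph \<Rightarrow> (real^'n) set" where
  "laplacian_polytope D = convex hull (range (\<lambda>i. row i (laplacian D)))"

text \<open>The lattice $H \cap \mathbb{Z}^n$ of integer points of coordinate sum zero.\<close>

definition sum_zero_lattice :: "(real^'n::finite) set" where
  "sum_zero_lattice = {x. (\<Sum>i\<in>UNIV. x $ i) = 0 \<and> (\<forall>i. x $ i \<in> \<int>)}"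

text \<open>
  The name \<open>connected\<close> is qualified because it is also the topological notion; here it means
  that the underlying undirected graph is connected.
\<close>

definition converging_tree :: "('v, 'e) pre_digraph \<Rightarrow> 'v \<Rightarrow> bool" where
  "converging_tree T r \<longleftrightarrow>
     fin_digraph T \<and> loopfree_digraph T \<and> Digraph_Component.connected T \<and>
     r \<in> verts T \<and> out_degree T r = 0 \<and> (\<forall>v \<in> verts T - {r}. out_degree T v = 1)"

text \<open>
  A subgraph in the sense of \<open>subgraph\<close> has the same tail and head functions as \<open>D\<close>, so
  spanning subgraphs are in bijection with sets of arcs.
\<close>

definition num_converging_trees :: "('v, 'e) pre_digraph \<Rightarrow> 'v \<Rightarrow> nat" where
  "num_converging_trees D r = card {T. spanning T D \<and> converging_tree T r}"


section \<open>Lattices and unimodular equivalence\<close>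

definition lattice_of_rank :: "nat \<Rightarrow> 'a::real_vector set \<Rightarrow> bool" where
  "lattice_of_rank r N \<longleftrightarrow> (\<exists>B. finite B \<and> card B = r \<and> independent B \<and> N = group_closure B)"

definition primitive_in :: "'a::real_vector set \<Rightarrow> 'a \<Rightarrow> bool" where
  "primitive_in N w \<longleftrightarrow>
     w \<in> N \<and> w \<noteq> 0 \<and> (\<forall>u\<in>N. \<forall>k::int. w = of_int k *\<^sub>R u \<longrightarrow> \<bar>k\<bar> = 1)"

text \<open>
  \<open>P\<close> and \<open>Q\<close> lie in the real spans of the lattices \<open>N\<close> and \<open>M\<close>.  Every affine isomorphism
  between these spans extends to a map \<open>\<lambda>x. f x + t\<close> of the surrounding spaces with \<open>f\<close> linear,
  so only injectivity of \<open>f\<close> on \<open>span N\<close> is required.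
\<close>

definition unimodularly_equivalent ::
    "'a::real_vector set \<Rightarrow> 'a set \<Rightarrow> 'b::real_vector set \<Rightarrow> 'b set \<Rightarrow> bool" where
  "unimodularly_equivalent N P M Q \<longleftrightarrow>
     (\<exists>f t. linear f \<and> inj_on f (span N) \<and>
        (\<lambda>x. f x + t) ` N = M \<and> (\<lambda>x. f x + t) ` P = Q)"


section \<open>Weighted projective spaces as lattice simplices\<close>

definition well_formed_weights :: "('n::finite \<Rightarrow> nat) \<Rightarrow> bool" where
  "well_formed_weights q \<longleftrightarrow> (\<forall>i. Gcd (q ` (UNIV - {i})) = 1)"

text \<open>
  The vertices $w_i$ of the simplex of $\mathbb{P}(q_1,\ldots,q_n)$: they generate a
  lattice of rank $n-1$ and satisfy $\sum_i q_i w_i = 0$.  These two conditions determine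
  the $w_i$ up to lattice isomorphism, namely as the images of the unit vectors in
  $\mathbb{Z}^n / \mathbb{Z}q$.  Primitivity of the $w_i$ can be satisfied only if the
  weights are well-formed (lemma \<open>primitive_imp_well_formed\<close> below; for instance there are no
  primitive $w_1, w_2$ for $\mathbb{P}(1,3)$), so it is imposed exactly in
  that case.
\<close>

definition wps_vertices ::
    "('n::finite \<Rightarrow> nat) \<Rightarrow> 'a::real_vector set \<Rightarrow> ('n \<Rightarrow> 'a) \<Rightarrow> bool" where
  "wps_vertices q M w \<longleftrightarrow>
     lattice_of_rank (CARD('n) - 1) M \<and>
     group_closure (range w) = M \<and>
     (\<Sum>i\<in>UNIV. real (q i) *\<^sub>R w i) = 0 \<and>
     (well_formed_weights q \<longrightarrow> (\<forall>i. primitive_in M (w i)))"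

text \<open>
  Every lattice of rank $n-1$ is isomorphic to one inside \<open>real^'n\<close>, so letting \<open>M\<close> range over
  the lattices in that space is no restriction.
\<close>

definition equivalent_to_wps :: "(real^'n::finite) set \<Rightarrow> (real^'n) set \<Rightarrow> ('n \<Rightarrow> nat) \<Rightarrow> bool" where
  "equivalent_to_wps N P q \<longleftrightarrow>
     (\<forall>i. 0 < q i) \<and> Gcd (range q) = 1 \<and>
     (\<exists>(M :: (real^'n) set) w. wps_vertices q M w \<and>
        unimodularly_equivalent N P M (convex hull (range w)))"

lemma group_closure_scaleR_int:
  fixes x :: "'a::real_vector"
  assumes "x \<in> group_closure S"
  shows "of_int k *\<^sub>R x \<in> group_closure S"
proof -
  have nat: "of_nat m *\<^sub>R x \<in> group_closure S" for m :: nat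
    by (induction m) (auto simp: scaleR_left_distrib intro: group_closure_add assms)
  show ?thesis
  proof (cases k rule: int_cases2)
    case (nonneg m)
    then show ?thesis using nat[of m] by simp
  next
    case (nonpos m)
    then show ?thesis using nat[of m] by simp
  qed
qed

lemma primitive_imp_well_formed:
  fixes w :: "'n::finite \<Rightarrow> 'a::real_vector"
  assumes gcd1: "Gcd (range q) = 1"
    and rel: "(\<Sum>i\<in>UNIV. real (q i) *\<^sub>R w i) = 0"
    and prim: "\<And>i. primitive_in (group_closure (range w)) (w i)"
  shows "well_formed_weights q"
  unfolding well_formed_weights_def
proof
  fix i
  define N where "N = group_closure (range w)"
  define d where "d = Gcd (q ` (UNIV - {i}))"
  define s where "s = (\<Sum>j\<in>UNIV - {i}. of_int (int (q j div d)) *\<^sub>R w j)"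
  have wN: "w j \<in> N" for j
    unfolding N_def by (rule group_closure.base) simp
  have sumN: "(\<Sum>j\<in>A. of_int (c j) *\<^sub>R w j) \<in> N" for A c
    unfolding N_def
    by (induction A rule: infinite_finite_induct)
      (auto intro!: group_closure_add group_closure_scaleR_int wN[unfolded N_def])
  have "s \<in> N"
    unfolding s_def by (rule sumN)
  have ds: "real d *\<^sub>R s = (\<Sum>j\<in>UNIV - {i}. real (q j) *\<^sub>R w j)"
    unfolding s_def scaleR_sum_right
  proof (rule sum.cong)
    fix j assume "j \<in> UNIV - {i}"
    then have "d dvd q j" unfolding d_def by (intro Gcd_dvd) auto
    then have "real d * real (q j div d) = real (q j)"
      by (metis dvd_mult_div_cancel of_nat_mult)
    then show "real d *\<^sub>R of_int (int (q j div d)) *\<^sub>R w j = real (q j) *\<^sub>R w j"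
      by simp
  qed simp
  have rel': "real (q i) *\<^sub>R w i = - (real d *\<^sub>R s)"
    using rel ds by (simp add: sum.remove[of UNIV i] eq_neg_iff_add_eq_0)
  have "range q = insert (q i) (q ` (UNIV - {i}))" by auto
  then have "gcd (q i) d = 1" using gcd1 by (simp add: d_def)
  then have "gcd (int (q i)) (int d) = 1" by simp
  then obtain a b where ab: "a * int (q i) + b * int d = 1"
    using bezout_int[of "int (q i)" "int d"] by auto
  define u where "u = of_int b *\<^sub>R w i - of_int a *\<^sub>R s"
  have "u \<in> N"
    unfolding u_def N_def
    using wN \<open>s \<in> N\<close> by (auto intro!: group_closure.diff group_closure_scaleR_int simp: N_def)
  have "1 = real_of_int a * real (q i) + real_of_int b * real d"
    using arg_cong[OF ab, of real_of_int] by simp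
  then have "w i = (real_of_int a * real (q i) + real_of_int b * real d) *\<^sub>R w i" by simp
  also have "\<dots> = of_int a *\<^sub>R (real (q i) *\<^sub>R w i) + (of_int b * real d) *\<^sub>R w i"
    by (simp add: scaleR_left_distrib)
  also have "\<dots> = of_int (int d) *\<^sub>R u"
    unfolding rel' u_def by (simp add: scaleR_right_diff_distrib mult.commute)
  finally have "\<bar>int d\<bar> = 1"
    using prim[of i] \<open>u \<in> N\<close> unfolding primitive_in_def N_def by blast
  then show "Gcd (q ` (UNIV - {i})) = 1" by (simp add: d_def)
qed

end

theory Submission
  imports Defs
begin

text \<open>
  Let \<open>v\<^sub>i\<close> be the rows of the Laplacian. By the matrix tree theorem \<open>c\<^sub>r\<close> is the cofactor of the
  Laplacian at the diagonal position \<open>r\<close>. As all row sums vanish, Cramer's rule yields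
  \<open>\<Sum>\<^sub>i c\<^sub>i v\<^sub>i = 0\<close> and shows that \<open>c\<^sub>r x\<close> is an integer combination of the \<open>v\<^sub>i\<close> for each integer
  point \<open>x\<close> of sum zero. Since the \<open>c\<^sub>r\<close> are coprime, the \<open>v\<^sub>i\<close> therefore generate the lattice, so
  they are themselves the vertices of the simplex of the weighted projective space and the
  equivalence is the identity.
\<close>

section \<open>Diagonal cofactors of matrices with zero row sums\<close>

definition replace_row :: "'a^'m^'n \<Rightarrow> 'n::finite \<Rightarrow> 'a^'m \<Rightarrow> 'a^'m^'n" where
  "replace_row A k x = (\<chi> i. if i = k then x else A $ i)"

text \<open>
  Replacing row \<open>r\<close> by a unit vector stands for deleting row and column \<open>r\<close>, which would change the
  index type.
\<close>

definition diag_cofactor :: "real^'n^'n \<Rightarrow> 'n::finite \<Rightarrow> real" where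
  "diag_cofactor A r = det (replace_row A r (axis r 1))"

definition zero_row_sums :: "real^'n^'n::finite \<Rightarrow> bool" where
  "zero_row_sums A \<longleftrightarrow> (\<forall>i. (\<Sum>j\<in>UNIV. A $ i $ j) = 0)"

lemma replace_row_nth [simp]: "replace_row A k x $ i = (if i = k then x else A $ i)"
  by (simp add: replace_row_def)

lemma det_replace_row_add:
  fixes A :: "real^'n^'n"
  shows "det (replace_row A k (x + y)) = det (replace_row A k x) + det (replace_row A k y)"
  unfolding replace_row_def by (rule det_row_add)

lemma det_replace_row_scaleR:
  fixes A :: "real^'n^'n"
  shows "det (replace_row A k (c *\<^sub>R x)) = c * det (replace_row A k x)"
  unfolding replace_row_def scalar_mult_eq_scaleR[symmetric] by (rule det_row_mul)

text \<open>Cramer's rule on the rows: by multilinearity every summand but the \<open>k\<close>-th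
  repeats another row and drops out.\<close>

lemma det_replace_row_combination:
  fixes A :: "real^'n^'n"
  shows "det (replace_row A k (\<Sum>i\<in>UNIV. y i *\<^sub>R A $ i)) = y k * det A"
  using cramer_lemma_transpose[where A = A and x = "\<chi> i. y i" and k = k]
  by (simp add: replace_row_def row_def scalar_mult_eq_scaleR cong: if_cong)

lemma det_zero_row_sums:
  assumes "zero_row_sums (A :: real^'n^'n)"
  shows "det A = 0"
proof -
  \<comment> \<open>\<open>1\<close> is the all-ones vector, which zero row sums put into the
    kernel.\<close>
  have "A *v 1 = 0"
    using assms by (simp add: vec_eq_iff matrix_vector_mult_def zero_row_sums_def)
  moreover have "(1 :: real^'n) \<noteq> 0" by simp
  ultimately show ?thesis
    by (metis invertible_det_nz invertible_left_inverse matrix_left_invertible_ker)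
qed

text \<open>A difference of two unit vectors has coordinate sum zero, so a matrix with it in row
  \<open>k\<close> still has zero row sums and is singular. Hence all cofactors along one row
  agree.\<close>

lemma det_replace_row_axis:
  assumes "zero_row_sums (A :: real^'n^'n)"
  shows "det (replace_row A k (axis s 1)) = diag_cofactor A k"
proof -
  have "zero_row_sums (replace_row A k (axis s 1 + (- 1) *\<^sub>R axis k 1))"
    using assms by (simp add: zero_row_sums_def sum.distrib sum_subtractf sum_negf axis_def)
  from det_zero_row_sums[OF this] show ?thesis
    unfolding det_replace_row_add det_replace_row_scaleR diag_cofactor_def by simp
qed

lemma det_swap_rows:
  fixes B :: "real^'n^'n"
  assumes "i \<noteq> j"
  shows "det (replace_row (replace_row B i (B $ j)) j (B $ i)) = - det B"
proof -
  have "replace_row (replace_row B i (B $ j)) j (B $ i) = (\<chi> m. B $ Transposition.transpose i j m)"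
    using assms by (simp add: vec_eq_iff Transposition.transpose_def)
  then show ?thesis
    using det_permute_rows[of "Transposition.transpose i j" B] assms
    by (simp add: permutes_swap_id sign_swap_id)
qed

text \<open>Exchanging rows \<open>r\<close> and \<open>k\<close> leads to \<open>A\<close> with row
  \<open>k\<close> replaced by \<open>axis r 1\<close>, whose determinant does not depend on the
  position of the 1.\<close>

lemma det_replace_two_rows:
  assumes "zero_row_sums (A :: real^'n^'n)" and "k \<noteq> r"
  shows "det (replace_row (replace_row A r (axis r 1)) k (A $ r)) = - diag_cofactor A k"
proof -
  define B where "B = replace_row A k (axis r 1)"
  have "replace_row (replace_row A r (axis r 1)) k (A $ r) =
      replace_row (replace_row B r (B $ k)) k (B $ r)"
    using \<open>k \<noteq> r\<close> by (simp add: B_def vec_eq_iff)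
  then have "det (replace_row (replace_row A r (axis r 1)) k (A $ r)) = - det B"
    using det_swap_rows[of r k B] \<open>k \<noteq> r\<close> by simp
  then show ?thesis
    using det_replace_row_axis[OF assms(1)] by (simp add: B_def)
qed

text \<open>The relation expresses \<open>b r\<close> times row \<open>r\<close> by the other rows
  with coefficients \<open>- b i\<close>. Cramer's rule, in the matrix whose row \<open>r\<close> is
  a unit vector, reads off the coefficient of row \<open>k\<close>; up to sign, the determinants
  involved are diagonal cofactors.\<close>

lemma left_kernel_proportional_diag_cofactor:
  fixes A :: "real^'n^'n"
  assumes "zero_row_sums A" and b: "(\<Sum>i\<in>UNIV. b i *\<^sub>R A $ i) = 0"
  shows "b k * diag_cofactor A r = b r * diag_cofactor A k"
proof (cases "k = r")
  case False
  define B where "B = replace_row A r (axis r 1)"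
  \<comment> \<open>The value 0 at \<open>r\<close> keeps the unit vector in that row out of the
    combination.\<close>
  define y where "y i = (if i = r then 0 else - b i)" for i
  have "(\<Sum>i\<in>UNIV. y i *\<^sub>R B $ i) = (\<Sum>i\<in>UNIV - {r}. - (b i *\<^sub>R A $ i))"
    by (rule sum.mono_neutral_cong_right) (auto simp: y_def B_def)
  also have "\<dots> = b r *\<^sub>R A $ r"
    using b by (simp add: sum_negf sum.remove[of UNIV r] eq_neg_iff_add_eq_0 add.commute
        neg_eq_iff_add_eq_0)
  finally have "det (replace_row B k (b r *\<^sub>R A $ r)) = y k * det B"
    using det_replace_row_combination[of B k y] by simp
  then show ?thesis
    using False det_replace_two_rows[OF assms(1) False]
    by (simp add: det_replace_row_scaleR B_def y_def diag_cofactor_def)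
qed simp

text \<open>Singularity supplies a nonzero \<open>b\<close> in the left kernel, and the cofactors
  are proportional to it. The factor may be 0, which covers rank below n - 1.\<close>

lemma diag_cofactor_left_kernel:
  fixes A :: "real^'n^'n"
  assumes "zero_row_sums A"
  shows "(\<Sum>i\<in>UNIV. diag_cofactor A i *\<^sub>R A $ i) = 0"
proof -
  have "\<not> invertible A"
    using det_zero_row_sums[OF assms] by (simp add: invertible_det_nz)
  then have "\<nexists>B. A ** B = mat 1"
    by (metis invertible_right_inverse)
  then obtain b i0 where b: "(\<Sum>i\<in>UNIV. b i *\<^sub>R A $ i) = 0" and i0: "b i0 \<noteq> 0"
    unfolding matrix_right_invertible_independent_rows
    by (auto simp: row_def vec_lambda_eta scalar_mult_eq_scaleR)
  have C: "diag_cofactor A i = (diag_cofactor A i0 / b i0) * b i" for i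
    using left_kernel_proportional_diag_cofactor[OF assms b, of i i0] i0 by (simp add: field_simps)
  have "(\<Sum>i\<in>UNIV. diag_cofactor A i *\<^sub>R A $ i) =
      (diag_cofactor A i0 / b i0) *\<^sub>R (\<Sum>i\<in>UNIV. b i *\<^sub>R A $ i)"
    unfolding scaleR_sum_right scaleR_scaleR by (intro sum.cong refl arg_cong2[where f = scaleR] C)
  with b show ?thesis by simp
qed

section \<open>Integer matrices and the lattice of their rows\<close>

lemma det_Ints:
  fixes A :: "real^'n^'n"
  assumes "\<And>i j. A $ i $ j \<in> \<int>"
  shows "det A \<in> \<int>"
  unfolding det_def using assms by (intro Ints_sum Ints_mult Ints_prod Ints_of_int) auto

text \<open>If the cofactor is nonzero, \<open>x\<close> is a real combination of the rows of
  \<open>B\<close>, and by Cramer's rule the cofactor clears the denominators of its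
  coefficients.\<close>

lemma diag_cofactor_scaleR_in_row_lattice:
  fixes A :: "real^'n^'n"
  assumes A: "zero_row_sums A" "\<And>i j. A $ i $ j \<in> \<int>"
    and x: "(\<Sum>j\<in>UNIV. x $ j) = 0" "\<And>j. x $ j \<in> \<int>"
  obtains a :: "'n \<Rightarrow> int" where "diag_cofactor A r *\<^sub>R x = (\<Sum>i\<in>UNIV. of_int (a i) *\<^sub>R A $ i)"
proof (cases "diag_cofactor A r = 0")
  case True
  then show ?thesis using that[of "\<lambda>_. 0"] by simp
next
  case False
  define B where "B = replace_row A r (axis r 1)"
  have nz: "det B \<noteq> 0" using False by (simp add: B_def diag_cofactor_def)
  then have "surj ((*v) (Finite_Cartesian_Product.transpose B))"
    by (metis det_transpose invertible_det_nz invertible_right_inverse matrix_right_invertible_surjective)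
  then obtain z where "x = Finite_Cartesian_Product.transpose B *v z" by (metis surjD)
  then have x_eq: "x = (\<Sum>i\<in>UNIV. z $ i *\<^sub>R B $ i)"
    by (simp add: vec_eq_iff matrix_vector_mult_def transpose_def mult.commute)
  have int: "z $ k * det B \<in> \<int>" for k
    using det_replace_row_combination[of B k "\<lambda>i. z $ i"] x_eq
      det_Ints[of "replace_row B k x"] A x by (auto simp: B_def axis_def split: if_splits)
  \<comment> \<open>Compare coordinate sums: \<open>x\<close> and all rows of \<open>B\<close>
    except the unit vector have sum zero, so the unit vector has coefficient 0.\<close>
  have "0 = (\<Sum>i\<in>UNIV. z $ i * (\<Sum>j\<in>UNIV. B $ i $ j))"
    unfolding x(1)[symmetric] x_eq by (simp add: sum_distrib_left) (rule sum.swap)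
  also have "\<dots> = (\<Sum>i\<in>UNIV. if i = r then z $ r else 0)"
    using A(1) by (intro sum.cong) (auto simp: zero_row_sums_def B_def axis_def)
  finally have zr: "z $ r = 0" by simp
  have "x = (\<Sum>i\<in>UNIV. z $ i *\<^sub>R A $ i)"
    unfolding x_eq by (intro sum.cong) (auto simp: B_def zr)
  moreover have "det B * z $ i = of_int \<lfloor>z $ i * det B\<rfloor>" for i
    using int[of i] by (simp add: mult.commute)
  ultimately have "det B *\<^sub>R x = (\<Sum>i\<in>UNIV. of_int \<lfloor>z $ i * det B\<rfloor> *\<^sub>R A $ i)"
    by (simp add: scaleR_sum_right)
  then show ?thesis
    using that by (simp add: B_def diag_cofactor_def)
qed

section \<open>The matrix tree theorem for converging trees\<close>

text \<open>
  Expanding the determinant of the reduced Laplacian by multilinearity in the rows turns it into a sum over functional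
  graphs, each of which contributes \<open>1\<close> or \<open>0\<close> according to whether it is a tree.
\<close>

lemma det_sum_rows_PiE:
  fixes a :: "'n::finite \<Rightarrow> 'e \<Rightarrow> 'a::comm_ring_1^'n"
  assumes "\<And>i. finite (S i)"
  shows "det (\<chi> i. if i \<in> T then (\<Sum>e\<in>S i. a i e) else c i) =
    (\<Sum>f\<in>Pi\<^sub>E T S. det (\<chi> i. if i \<in> T then a i (f i) else c i))"
proof (induction T arbitrary: c rule: infinite_finite_induct)
  case (insert k T)
  let ?A = "\<lambda>f e. (\<chi> i. if i = k then a k e else if i \<in> T then a i (f i) else c i) :: 'a^'n^'n"
  \<comment> \<open>Row \<open>k\<close> is first hidden among the fixed rows \<open>c\<close>, so
    that the induction hypothesis expands the rows in \<open>T\<close>; row \<open>k\<close> is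
    expanded afterwards.\<close>
  have "det (\<chi> i. if i \<in> insert k T then (\<Sum>e\<in>S i. a i e) else c i) =
      det (\<chi> i. if i \<in> T then (\<Sum>e\<in>S i. a i e) else if i = k then (\<Sum>e\<in>S k. a k e) else c i)"
    by (intro arg_cong[where f = det] Cart_lambda_cong) (use insert.hyps in auto)
  also have "\<dots> = (\<Sum>f\<in>Pi\<^sub>E T S. det (\<chi> i. if i \<in> T then a i (f i)
      else if i = k then (\<Sum>e\<in>S k. a k e) else c i))"
    by (rule insert.IH)
  also have "\<dots> = (\<Sum>f\<in>Pi\<^sub>E T S. det (\<chi> i. if i = k then (\<Sum>e\<in>S k. a k e)
      else if i \<in> T then a i (f i) else c i))"
    by (intro sum.cong refl arg_cong[where f = det] Cart_lambda_cong) (use insert.hyps in auto)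
  also have "\<dots> = (\<Sum>f\<in>Pi\<^sub>E T S. \<Sum>e\<in>S k. det (?A f e))"
    by (intro sum.cong refl det_linear_row_sum assms)
  also have "\<dots> = (\<Sum>(e, f)\<in>S k \<times> Pi\<^sub>E T S. det (?A f e))"
    by (subst sum.swap) (rule sum.cartesian_product)
  also have "\<dots> = (\<Sum>f\<in>Pi\<^sub>E (insert k T) S.
      det (\<chi> i. if i \<in> insert k T then a i (f i) else c i))"
    unfolding PiE_insert_eq
    by (subst sum.reindex[OF inj_combinator[OF insert.hyps(2)]])
      (use insert.hyps in \<open>auto intro!: sum.cong arg_cong[where f = det] Cart_lambda_cong\<close>)
  finally show ?case .
qed (simp_all)

section \<open>Determinants triangular along a rank function\<close>

text \<open>A moved point would make the sum of all ranks strictly smaller, yet a permutation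
  preserves this sum.\<close>

lemma permutation_eq_id_of_rank:
  fixes t :: "'n::finite \<Rightarrow> nat"
  assumes "p permutes UNIV" and "\<And>i. p i = i \<or> t (p i) < t i"
  shows "p = id"
proof (rule ccontr)
  assume "p \<noteq> id"
  then obtain i where "p i \<noteq> i" by (auto simp: fun_eq_iff)
  then have "t (p i) < t i" using assms(2)[of i] by simp
  moreover have "t (p j) \<le> t j" for j
    using assms(2)[of j] by auto
  ultimately have "(\<Sum>j\<in>UNIV. t (p j)) < (\<Sum>j\<in>UNIV. t j)"
    by (intro sum_strict_mono_ex1) auto
  then show False
    using sum.permute[OF assms(1), of t] by (simp add: o_def)
qed

text \<open>The rank \<open>t\<close> stands in for an order on the index type; only the identity
  survives in the Leibniz expansion.\<close>

lemma det_triangular_of_rank: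
  fixes A :: "'a::comm_ring_1^'n^'n" and t :: "'n \<Rightarrow> nat"
  assumes "\<And>i j. i \<noteq> j \<Longrightarrow> A $ i $ j \<noteq> 0 \<Longrightarrow> t j < t i"
  shows "det A = (\<Prod>i\<in>UNIV. A $ i $ i)"
proof -
  let ?P = "\<lambda>p. of_int (sign p) * (\<Prod>i\<in>UNIV. A $ i $ p i)"
  have "?P p = 0" if "p permutes UNIV" "p \<noteq> id" for p
  proof -
    obtain i where "p i \<noteq> i" "\<not> t (p i) < t i"
      using permutation_eq_id_of_rank[of p t] \<open>p permutes UNIV\<close> \<open>p \<noteq> id\<close> by blast
    then have "A $ i $ p i = 0" using assms[of i "p i"] by metis
    then have "(\<Prod>i\<in>UNIV. A $ i $ p i) = 0" by (intro prod_zero) auto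
    then show ?thesis by simp
  qed
  then have "det A = sum ?P {id}"
    unfolding det_def by (intro sum.mono_neutral_right) (auto simp: permutes_id)
  then show ?thesis by (simp add: sign_id)
qed

section \<open>Functional graphs with a sink\<close>

text \<open>The graph of \<open>g\<close> with \<open>r\<close> made a sink, so the value
  \<open>g r\<close> never matters.\<close>

definition successor_rel :: "('n \<Rightarrow> 'n) \<Rightarrow> 'n \<Rightarrow> ('n \<times> 'n) set" where
  "successor_rel g r = {(v, g v) |v. v \<noteq> r}"

text \<open>The reduced Laplacian of this graph. The condition \<open>v \<in> - {r}\<close> fits the
  multilinear expansion of the rows in \<open>- {r}\<close>.\<close>

definition successor_matrix :: "('n \<Rightarrow> 'n) \<Rightarrow> 'n::finite \<Rightarrow> real^'n^'n" where
  "successor_matrix g r = (\<chi> v. if v \<in> - {r} then axis v 1 - axis (g v) 1 else axis r 1)"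

lemma successor_rel_step:
  assumes "v \<noteq> r"
  shows "(v, r) \<in> (successor_rel g r)\<^sup>* \<longleftrightarrow> (g v, r) \<in> (successor_rel g r)\<^sup>*"
proof
  assume "(v, r) \<in> (successor_rel g r)\<^sup>*"
  then show "(g v, r) \<in> (successor_rel g r)\<^sup>*"
    using assms by (cases rule: converse_rtranclE) (auto simp: successor_rel_def)
next
  assume "(g v, r) \<in> (successor_rel g r)\<^sup>*"
  moreover have "(v, g v) \<in> successor_rel g r"
    using assms by (auto simp: successor_rel_def)
  ultimately show "(v, r) \<in> (successor_rel g r)\<^sup>*"
    by (rule converse_rtrancl_into_rtrancl[rotated])
qed

text \<open>The distance to \<open>r\<close> is such a rank, since a shortest path from
  \<open>v\<close> has to start with the edge to \<open>g v\<close>.\<close>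

lemma successor_rel_rank:
  assumes "\<forall>v. (v, r) \<in> (successor_rel g r)\<^sup>*"
  obtains t :: "'n \<Rightarrow> nat" where "\<And>v. v \<noteq> r \<Longrightarrow> t (g v) < t v"
proof
  define t where "t v = (LEAST n. (v, r) \<in> successor_rel g r ^^ n)" for v
  fix v assume "v \<noteq> r"
  have "\<exists>n. (v, r) \<in> successor_rel g r ^^ n"
    using assms by (simp add: rtrancl_power)
  then have *: "(v, r) \<in> successor_rel g r ^^ t v"
    unfolding t_def by (rule LeastI_ex)
  with \<open>v \<noteq> r\<close> obtain m where m: "t v = Suc m" by (cases "t v") auto
  with * obtain u where "(v, u) \<in> successor_rel g r" "(u, r) \<in> successor_rel g r ^^ m"
    using relpow_Suc_D2 by metis
  then have "(g v, r) \<in> successor_rel g r ^^ m"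
    by (auto simp: successor_rel_def)
  then have "t (g v) \<le> m" unfolding t_def by (rule Least_le)
  then show "t (g v) < t v" using m by simp
qed

text \<open>If all vertices reach \<open>r\<close>, the matrix is triangular along the distance to
  \<open>r\<close>, with ones on the diagonal. Otherwise the indicator of the vertices that do not
  reach \<open>r\<close> is a nonzero kernel vector, because \<open>v\<close> reaches
  \<open>r\<close> exactly if \<open>g v\<close> does.\<close>

lemma det_successor_matrix:
  fixes g :: "'n::finite \<Rightarrow> 'n"
  shows "det (successor_matrix g r) = (if \<forall>v. (v, r) \<in> (successor_rel g r)\<^sup>* then 1 else 0)"
proof (cases "\<forall>v. (v, r) \<in> (successor_rel g r)\<^sup>*")
  case True
  then obtain t :: "'n \<Rightarrow> nat" where t: "\<And>v. v \<noteq> r \<Longrightarrow> t (g v) < t v"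
    using successor_rel_rank[of r g] by metis
  have "g v \<noteq> v" if "v \<noteq> r" for v
    using t[OF that] by auto
  then have "successor_matrix g r $ v $ v = 1" for v
    by (cases "v = r") (simp_all add: successor_matrix_def axis_def eq_commute[of v "g v"])
  moreover have "det (successor_matrix g r) = (\<Prod>v\<in>UNIV. successor_matrix g r $ v $ v)"
    by (rule det_triangular_of_rank[of _ t])
      (auto simp: successor_matrix_def axis_def t split: if_splits)
  ultimately show ?thesis using True by simp
next
  case False
  define x :: "real^'n" where "x = (\<chi> v. if (v, r) \<in> (successor_rel g r)\<^sup>* then 0 else 1)"
  have "successor_matrix g r *v x = 0"
    unfolding vec_eq_iff
  proof
    fix v
    show "(successor_matrix g r *v x) $ v = 0 $ v"
      using successor_rel_step[of v r g]
      by (auto simp: matrix_vector_mul_component successor_matrix_def inner_diff_left inner_axis' x_def)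
  qed
  moreover have "x \<noteq> 0" using False by (auto simp: x_def vec_eq_iff)
  ultimately have "det (successor_matrix g r) = 0"
    by (metis invertible_det_nz invertible_left_inverse matrix_left_invertible_ker)
  then show ?thesis using False by (simp only: if_False)
qed

section \<open>The reduced Laplacian determinant as a count\<close>

text \<open>One summand per arc is the form that multilinearity needs; parallel arcs stay
  distinct.\<close>

lemma laplacian_row:
  fixes D :: "('n::finite, 'e) pre_digraph"
  assumes "fin_digraph D"
  shows "laplacian D $ v = (\<Sum>e\<in>out_arcs D v. axis v 1 - axis (head D e) 1)"
proof -
  have fin: "finite (out_arcs D v)"
    using assms by (rule fin_digraph.finite_out_arcs)
  have "(\<Sum>e\<in>out_arcs D v. axis (head D e) 1 $ j :: real) =
      real (card {e \<in> arcs D. tail D e = v \<and> head D e = j})" for j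
  proof -
    have "(\<Sum>e\<in>out_arcs D v. axis (head D e) 1 $ j :: real) =
        (\<Sum>e\<in>{e \<in> out_arcs D v. head D e = j}. 1)"
      unfolding sum.inter_filter[OF fin] by (intro sum.cong) (auto simp: axis_def)
    also have "{e \<in> out_arcs D v. head D e = j} = {e \<in> arcs D. tail D e = v \<and> head D e = j}"
      by (auto simp: out_arcs_def)
    finally show ?thesis by simp
  qed
  then show ?thesis
    by (simp add: vec_eq_iff laplacian_def outdegree_matrix_def adjacency_matrix_def
        sum_subtractf out_degree_def axis_def[of v] del: sum_constant)
      (simp add: axis_def)
qed

lemma zero_row_sums_laplacian:
  assumes "fin_digraph D"
  shows "zero_row_sums (laplacian D)"
  unfolding zero_row_sums_def laplacian_row[OF assms] sum_component
  by (subst sum.swap) (simp add: sum_subtractf axis_def)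

lemma diag_cofactor_laplacian:
  fixes D :: "('n::finite, 'e) pre_digraph"
  assumes "fin_digraph D"
  shows "diag_cofactor (laplacian D) r =
    card {f \<in> Pi\<^sub>E (- {r}) (out_arcs D). \<forall>v. (v, r) \<in> (successor_rel (head D \<circ> f) r)\<^sup>*}"
proof -
  have fin: "finite (out_arcs D v)" for v
    using assms by (rule fin_digraph.finite_out_arcs)
  have "replace_row (laplacian D) r (axis r 1) =
      (\<chi> v. if v \<in> - {r} then (\<Sum>e\<in>out_arcs D v. axis v 1 - axis (head D e) 1) else axis r 1)"
    by (simp add: vec_eq_iff laplacian_row[OF assms])
  then have "diag_cofactor (laplacian D) r =
      (\<Sum>f\<in>Pi\<^sub>E (- {r}) (out_arcs D). det (successor_matrix (head D \<circ> f) r))"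
    unfolding diag_cofactor_def successor_matrix_def by (simp only: det_sum_rows_PiE[OF fin] o_def)
  also have "\<dots> = real (card {f \<in> Pi\<^sub>E (- {r}) (out_arcs D).
      \<forall>v. (v, r) \<in> (successor_rel (head D \<circ> f) r)\<^sup>*})"
    by (simp add: det_successor_matrix sum.If_cases finite_PiE fin Int_def)
  finally show ?thesis .
qed

text \<open>
  A spanning subgraph in which every vertex but \<open>r\<close> has exactly one outgoing arc is given by the
  choice of these arcs.
\<close>

definition choice_subgraph :: "('v, 'e) pre_digraph \<Rightarrow> 'v \<Rightarrow> ('v \<Rightarrow> 'e) \<Rightarrow> ('v, 'e) pre_digraph" where
  "choice_subgraph D r f = D\<lparr>arcs := f ` (- {r})\<rparr>"

text \<open>Reaching \<open>r\<close> is passed along edges in both directions, as every vertex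
  other than \<open>r\<close> has a single way out; so it spreads along undirected paths.\<close>

lemma connected_iff_reaches_root:
  fixes T :: "('v, 'e) pre_digraph"
  assumes "wf_digraph T" and "verts T = UNIV" and ends: "arcs_ends T = successor_rel g r"
  shows "Digraph_Component.connected T \<longleftrightarrow> (\<forall>v. (v, r) \<in> (successor_rel g r)\<^sup>*)"
proof -
  interpret wf_digraph T by fact
  interpret S: pair_wf_digraph "mk_symmetric T" ..
  have sym_ends: "parcs (mk_symmetric T) = successor_rel g r \<union> (successor_rel g r)\<inverse>"
    unfolding ends[symmetric] by (auto simp: parcs_mk_symmetric arcs_ends_conv)
  show ?thesis
  proof
    assume con: "Digraph_Component.connected T"
    show "\<forall>v. (v, r) \<in> (successor_rel g r)\<^sup>*"
    proof
      fix v
      have "v \<rightarrow>\<^sup>*\<^bsub>mk_symmetric T\<^esub> r"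
        using con assms(2) by (auto simp: connected_def strongly_connected_def)
      then show "(v, r) \<in> (successor_rel g r)\<^sup>*"
      proof (induction rule: S.converse_reachable_induct)
        case (step x y)
        \<comment> \<open>In the second case \<open>x = g y\<close>, and the path from
          \<open>y\<close> to \<open>r\<close> must run through \<open>x\<close>.\<close>
        then consider "(x, y) \<in> successor_rel g r" | "(y, x) \<in> successor_rel g r"
          using sym_ends by auto
        then show ?case
          using step.IH successor_rel_step[of _ r g] by cases (auto simp: successor_rel_def)
      qed simp
    qed
  next
    assume reach: "\<forall>v. (v, r) \<in> (successor_rel g r)\<^sup>*"
    have "v \<rightarrow>\<^sup>*\<^bsub>mk_symmetric T\<^esub> r" for v
      using reach assms(2) by (intro reachable_mk_symmetricI) (simp add: reachable_conv ends)
    moreover have "symmetric (mk_symmetric T)"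
      by (auto simp: symmetric_def sym_def sym_ends)
    ultimately have "u \<rightarrow>\<^sup>*\<^bsub>mk_symmetric T\<^esub> v" for u v
      by (meson S.reachable_trans symmetric_reachable)
    then show "Digraph_Component.connected T"
      using assms(2) by (simp add: connected_def strongly_connected_def)
  qed
qed

section \<open>Converging trees as choices of outgoing arcs\<close>

lemma choice_subgraph_simps [simp]:
  "verts (choice_subgraph D r f) = verts D" "arcs (choice_subgraph D r f) = f ` (- {r})"
  "tail (choice_subgraph D r f) = tail D" "head (choice_subgraph D r f) = head D"
  by (simp_all add: choice_subgraph_def)

lemma choice_mem_out_arcs:
  assumes "f \<in> Pi\<^sub>E (- {r}) (out_arcs D)" and "v \<noteq> r"
  shows "f v \<in> arcs D" "tail D (f v) = v"
  using PiE_mem[OF assms(1), of v] assms(2) by (auto simp: out_arcs_def)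

lemma arcs_ends_choice_subgraph:
  assumes "f \<in> Pi\<^sub>E (- {r}) (out_arcs D)"
  shows "arcs_ends (choice_subgraph D r f) = successor_rel (head D \<circ> f) r"
  using choice_mem_out_arcs[OF assms] by (force simp: arcs_ends_conv successor_rel_def)

text \<open>The outdegree conditions hold by construction, which leaves connectedness.\<close>

lemma converging_tree_choice_subgraph_iff:
  fixes D :: "('n::finite, 'e) pre_digraph"
  assumes "fin_digraph D" "loopfree_digraph D" "verts D = UNIV"
    and f: "f \<in> Pi\<^sub>E (- {r}) (out_arcs D)"
  shows "converging_tree (choice_subgraph D r f) r \<longleftrightarrow>
    (\<forall>v. (v, r) \<in> (successor_rel (head D \<circ> f) r)\<^sup>*)"
proof -
  interpret fin_digraph D by fact
  interpret loopfree_digraph D by fact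
  let ?T = "choice_subgraph D r f"
  have fin: "fin_digraph ?T" using assms(3) by unfold_locales auto
  have "loopfree_digraph ?T"
    using assms(3) choice_mem_out_arcs[OF f] no_loops by unfold_locales auto
  moreover have "out_arcs ?T r = {}"
    using choice_mem_out_arcs(2)[OF f] by (force simp: out_arcs_def)
  moreover have "out_arcs ?T v = {f v}" if "v \<noteq> r" for v
    using that
    by (auto simp: out_arcs_def choice_mem_out_arcs[OF f]) (metis choice_mem_out_arcs(2)[OF f])
  moreover have "wf_digraph ?T" using fin by (rule fin_digraph.axioms)
  ultimately show ?thesis
    using fin connected_iff_reaches_root[OF _ _ arcs_ends_choice_subgraph[OF f]] assms(3)
    by (auto simp: converging_tree_def out_degree_def)
qed

lemma converging_tree_is_choice_subgraph:
  fixes D :: "('n::finite, 'e) pre_digraph"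
  assumes "verts D = UNIV" and "spanning T D" and tree: "converging_tree T r"
  obtains f where "f \<in> Pi\<^sub>E (- {r}) (out_arcs D)" and "T = choice_subgraph D r f"
proof -
  have sub: "arcs T \<subseteq> arcs D" "tail T = tail D" "head T = head D" "verts T = UNIV"
    using assms by (auto simp: spanning_def subgraph_def compatible_def)
  interpret fin_digraph T using tree by (simp add: converging_tree_def)
  have "\<exists>e. out_arcs T v = {e}" if "v \<noteq> r" for v
    using tree that sub(4) by (auto simp: converging_tree_def out_degree_def card_1_singleton_iff)
  then obtain h where h: "\<And>v. v \<noteq> r \<Longrightarrow> out_arcs T v = {h v}" by metis
  \<comment> \<open>\<open>restrict\<close> fixes the value at \<open>r\<close>, as membership in
    \<open>Pi\<^sub>E\<close> demands.\<close>
  define f where "f = restrict h (- {r})"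
  have hv: "h v \<in> arcs T" "tail T (h v) = v" if "v \<noteq> r" for v
    using h[OF that] by (auto simp: out_arcs_def)
  have "out_arcs T r = {}"
    using tree finite_out_arcs[of r] by (simp add: converging_tree_def out_degree_def)
  have "e \<in> h ` (- {r})" if "e \<in> arcs T" for e
  proof -
    have "e \<in> out_arcs T (tail T e)" using that by (simp add: out_arcs_def)
    moreover from this have "tail T e \<noteq> r" using \<open>out_arcs T r = {}\<close> by auto
    ultimately have "e = h (tail T e)" using h by auto
    with \<open>tail T e \<noteq> r\<close> show ?thesis by blast
  qed
  then have "arcs T = h ` (- {r})"
    using hv(1) by auto
  then have "T = choice_subgraph D r f"
    using sub assms(1) by (intro pre_digraph.equality) (auto simp: f_def)
  moreover have "h v \<in> out_arcs D v" if "v \<noteq> r" for v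
    using hv[OF that] sub by (auto simp: out_arcs_def)
  then have "f \<in> Pi\<^sub>E (- {r}) (out_arcs D)"
    by (auto simp: f_def)
  ultimately show ?thesis using that by blast
qed

text \<open>The tail of an arc tells which vertex has chosen it.\<close>

lemma inj_on_choice_subgraph: "inj_on (choice_subgraph D r) (Pi\<^sub>E (- {r}) (out_arcs D))"
proof (rule inj_onI)
  fix f g assume f: "f \<in> Pi\<^sub>E (- {r}) (out_arcs D)" and g: "g \<in> Pi\<^sub>E (- {r}) (out_arcs D)"
    and "choice_subgraph D r f = choice_subgraph D r g"
  then have im: "f ` (- {r}) = g ` (- {r})"
    by (metis choice_subgraph_simps(2))
  show "f = g"
  proof (rule PiE_ext[OF f g])
    fix v assume "v \<in> - {r}"
    then obtain u where "u \<noteq> r" "f v = g u" using im by (force simp: set_eq_iff image_iff)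
    then show "f v = g v"
      using choice_mem_out_arcs[OF f, of v] choice_mem_out_arcs[OF g, of u] \<open>v \<in> - {r}\<close> by auto
  qed
qed

text \<open>The cofactor counts the choices of arcs that lead every vertex to \<open>r\<close>, and
  \<open>choice_subgraph\<close> maps these bijectively onto the trees.\<close>

theorem matrix_tree:
  fixes D :: "('n::finite, 'e) pre_digraph"
  assumes "fin_digraph D" "loopfree_digraph D" "verts D = UNIV"
  shows "diag_cofactor (laplacian D) r = real (num_converging_trees D r)"
proof -
  interpret fin_digraph D by fact
  let ?F = "{f \<in> Pi\<^sub>E (- {r}) (out_arcs D). \<forall>v. (v, r) \<in> (successor_rel (head D \<circ> f) r)\<^sup>*}"
  have "spanning (choice_subgraph D r f) D" if "f \<in> Pi\<^sub>E (- {r}) (out_arcs D)" for f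
    using choice_mem_out_arcs[OF that] wf_digraph assms(3)
    by (auto simp: spanning_def subgraph_def compatible_def wf_digraph_def)
  then have "choice_subgraph D r ` ?F = {T. spanning T D \<and> converging_tree T r}"
    using converging_tree_choice_subgraph_iff[OF assms]
    by (auto elim!: converging_tree_is_choice_subgraph[OF assms(3)])
  moreover have "inj_on (choice_subgraph D r) ?F"
    using inj_on_choice_subgraph by (rule inj_on_subset) auto
  from card_image[OF this] have "card (choice_subgraph D r ` ?F) = card ?F" .
  ultimately have "num_converging_trees D r = card ?F"
    by (simp only: num_converging_trees_def)
  then show ?thesis
    unfolding diag_cofactor_laplacian[OF assms(1)] by simp
qed

section \<open>Integer combinations and the lattice of sum zero\<close>

lemma group_closure_sum:
  fixes w :: "'i \<Rightarrow> 'a::real_vector"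
  assumes "\<And>i. i \<in> A \<Longrightarrow> w i \<in> group_closure S"
  shows "(\<Sum>i\<in>A. of_int (c i) *\<^sub>R w i) \<in> group_closure S"
  using assms
  by (induction A rule: infinite_finite_induct)
    (auto intro: group_closure_add group_closure_scaleR_int)

lemma group_closure_rangeE:
  fixes w :: "'i::finite \<Rightarrow> 'a::real_vector"
  assumes "x \<in> group_closure (range w)"
  obtains a :: "'i \<Rightarrow> int" where "x = (\<Sum>i\<in>UNIV. of_int (a i) *\<^sub>R w i)"
proof -
  have "\<exists>a :: 'i \<Rightarrow> int. x = (\<Sum>i\<in>UNIV. of_int (a i) *\<^sub>R w i)"
    using assms
  proof induction
    case (base s)
    show ?case
    \<comment> \<open>The base rule of \<open>group_closure\<close> admits 0 besides the
      generators.\<close>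
    proof (cases "s = 0")
      case True
      then show ?thesis by (intro exI[of _ "\<lambda>_. 0"]) simp
    next
      case False
      with base obtain j where "s = w j" by auto
      then have "s = (\<Sum>i\<in>UNIV. of_int (if i = j then 1 else 0) *\<^sub>R w i)"
        by (simp add: if_distrib[of "\<lambda>c. c *\<^sub>R _"] if_distrib[of of_int] cong: if_cong)
      then show ?thesis by (rule exI[of _ "\<lambda>i. if i = j then 1 else 0"])
    qed
  next
    case (diff s t)
    then obtain a b :: "'i \<Rightarrow> int" where "s = (\<Sum>i\<in>UNIV. of_int (a i) *\<^sub>R w i)"
      "t = (\<Sum>i\<in>UNIV. of_int (b i) *\<^sub>R w i)" by blast
    then have "s - t = (\<Sum>i\<in>UNIV. of_int (a i - b i) *\<^sub>R w i)"
      by (simp add: sum_subtractf scaleR_left_diff_distrib)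
    then show ?case by (rule exI[of _ "\<lambda>i. a i - b i"])
  qed
  with that show ?thesis by blast
qed

text \<open>Bezout's identity, applied to one multiplier after the other; the start is
  \<open>Gcd {} = 0\<close>.\<close>

lemma Gcd_scaleR_in_group_closure:
  fixes x :: "'a::real_vector"
  assumes "finite A" and "\<And>q. q \<in> A \<Longrightarrow> real q *\<^sub>R x \<in> group_closure S"
  shows "real (Gcd A) *\<^sub>R x \<in> group_closure S"
  using assms
proof (induction A rule: finite_induct)
  case (insert q A)
  obtain a b where "a * int q + b * int (Gcd A) = gcd (int q) (int (Gcd A))"
    using bezout_int by blast
  then have "real (Gcd (insert q A)) = of_int a * real q + of_int b * real (Gcd A)"
    using arg_cong[of _ _ real_of_int] by fastforce
  then have "real (Gcd (insert q A)) *\<^sub>R x =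
      of_int a *\<^sub>R (real q *\<^sub>R x) + of_int b *\<^sub>R (real (Gcd A) *\<^sub>R x)"
    by (simp add: scaleR_left_distrib)
  also have "\<dots> \<in> group_closure S"
    using insert by (intro group_closure_add group_closure_scaleR_int) auto
  finally show ?case .
qed simp

section \<open>The lattice of integer points of sum zero\<close>

lemma group_closure_subset_sum_zero_lattice:
  fixes S :: "(real^'n) set"
  assumes "S \<subseteq> sum_zero_lattice"
  shows "group_closure S \<subseteq> sum_zero_lattice"
proof
  fix x assume "x \<in> group_closure S"
  then show "x \<in> sum_zero_lattice"
  proof induction
    case (base s)
    then show ?case using assms by (auto simp: sum_zero_lattice_def)
  next
    case (diff s t)
    then show ?case by (auto simp: sum_zero_lattice_def sum_subtractf)
  qed
qed

text \<open>The vectors \<open>axis s 1 - axis r 1\<close> form a basis for any fixed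
  \<open>r\<close>: the coefficients of a point are its coordinates away from \<open>r\<close>, and
  sum zero determines the remaining coordinate.\<close>

lemma lattice_of_rank_sum_zero_lattice:
  "lattice_of_rank (CARD('n) - 1) (sum_zero_lattice :: (real^'n::finite) set)"
proof -
  fix r :: 'n
  define b :: "'n \<Rightarrow> real^'n" where "b s = axis s 1 - axis r 1" for s
  define B where "B = b ` (- {r})"
  have comp: "(\<Sum>s\<in>- {r}. c s *\<^sub>R b s) $ j = c j" if "j \<noteq> r" for c :: "'n \<Rightarrow> real" and j
  proof -
    have "(\<Sum>s\<in>- {r}. c s *\<^sub>R b s) $ j = (\<Sum>s\<in>- {r}. if s = j then c j else 0)"
      unfolding sum_component by (intro sum.cong) (use that in \<open>auto simp: b_def axis_def\<close>)
    then show ?thesis using that by simp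
  qed
  have inj: "inj_on b (- {r})"
    by (auto simp: inj_on_def b_def axis_eq_axis)
  have "independent B"
  proof (rule independent_if_scalars_zero)
    fix f x assume sum0: "(\<Sum>x\<in>B. f x *\<^sub>R x) = 0" and "x \<in> B"
    then obtain j where "j \<noteq> r" "x = b j" by (auto simp: B_def)
    moreover have "(\<Sum>s\<in>- {r}. f (b s) *\<^sub>R b s) = 0"
      using sum0 by (simp add: B_def sum.reindex[OF inj])
    ultimately show "f x = 0" using comp[of j "\<lambda>s. f (b s)"] by simp
  qed (simp add: B_def)
  moreover have "card B = CARD('n) - 1"
    unfolding B_def card_image[OF inj] by (simp add: Compl_eq_Diff_UNIV)
  moreover have "group_closure B \<subseteq> sum_zero_lattice"
    by (rule group_closure_subset_sum_zero_lattice)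
      (auto simp: B_def b_def sum_zero_lattice_def axis_def sum_subtractf)
  moreover have "x \<in> group_closure B" if x: "x \<in> sum_zero_lattice" for x
  proof -
    have int: "of_int \<lfloor>x $ s\<rfloor> = x $ s" for s
      using x by (simp add: sum_zero_lattice_def)
    have "(\<Sum>s\<in>- {r}. x $ s *\<^sub>R b s) $ r = - (\<Sum>s\<in>- {r}. x $ s)"
      unfolding sum_component sum_negf[symmetric] by (intro sum.cong) (auto simp: b_def axis_def)
    also have "\<dots> = x $ r"
      using x by (simp add: sum_zero_lattice_def sum.remove[of UNIV r] Compl_eq_Diff_UNIV)
    finally have "(\<Sum>s\<in>- {r}. x $ s *\<^sub>R b s) $ j = x $ j" for j
      using comp[of j "\<lambda>s. x $ s"] by (cases "j = r") simp_all
    then have "x = (\<Sum>s\<in>- {r}. of_int \<lfloor>x $ s\<rfloor> *\<^sub>R b s)"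
      by (simp only: vec_eq_iff int) simp
    also have "\<dots> \<in> group_closure B"
      by (rule group_closure_sum) (auto simp: B_def intro: group_closure.base)
    finally show ?thesis .
  qed
  ultimately show ?thesis
    unfolding lattice_of_rank_def by (intro exI[of _ B]) (auto simp: B_def)
qed

section \<open>Laplacian simplices\<close>

lemma laplacian_rows_generate_sum_zero_lattice:
  fixes D :: "('n::finite, 'e) pre_digraph"
  assumes "fin_digraph D" "loopfree_digraph D" "verts D = UNIV"
    and gcd: "Gcd (range (num_converging_trees D)) = 1"
  shows "group_closure (range (\<lambda>i. laplacian D $ i)) = sum_zero_lattice"
proof
  let ?L = "laplacian D"
  have zero: "zero_row_sums ?L"
    using assms(1) by (rule zero_row_sums_laplacian)
  have int: "?L $ i $ j \<in> \<int>" for i j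
    by (simp add: laplacian_def outdegree_matrix_def adjacency_matrix_def)
  show "group_closure (range (\<lambda>i. ?L $ i)) \<subseteq> sum_zero_lattice"
    using zero int
    by (intro group_closure_subset_sum_zero_lattice) (auto simp: sum_zero_lattice_def zero_row_sums_def)
  show "sum_zero_lattice \<subseteq> group_closure (range (\<lambda>i. ?L $ i))"
  proof
    fix x :: "real^'n" assume x: "x \<in> sum_zero_lattice"
    have "real (num_converging_trees D r) *\<^sub>R x \<in> group_closure (range (\<lambda>i. ?L $ i))" for r
    proof -
      obtain a :: "'n \<Rightarrow> int"
        where "diag_cofactor ?L r *\<^sub>R x = (\<Sum>i\<in>UNIV. of_int (a i) *\<^sub>R ?L $ i)"
        using x diag_cofactor_scaleR_in_row_lattice[OF zero int]
        by (auto simp: sum_zero_lattice_def)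
      then show ?thesis
        unfolding matrix_tree[OF assms(1-3)] by (auto intro: group_closure_sum group_closure.base)
    qed
    then have "real (Gcd (range (num_converging_trees D))) *\<^sub>R x
        \<in> group_closure (range (\<lambda>i. ?L $ i))"
      by (intro Gcd_scaleR_in_group_closure) auto
    then show "x \<in> group_closure (range (\<lambda>i. ?L $ i))"
      by (simp add: gcd)
  qed
qed

lemma converging_trees_relation:
  fixes D :: "('n::finite, 'e) pre_digraph"
  assumes "fin_digraph D" "loopfree_digraph D" "verts D = UNIV"
  shows "(\<Sum>i\<in>UNIV. real (num_converging_trees D i) *\<^sub>R laplacian D $ i) = 0"
  using diag_cofactor_left_kernel[OF zero_row_sums_laplacian[OF assms(1)]]
  by (simp add: matrix_tree[OF assms])

text \<open>
  In the relation between the rows, the coordinate at a vertex without converging trees is a sum of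
  nonpositive terms, so all its predecessors have no converging trees either.
\<close>

lemma num_converging_trees_pos:
  fixes D :: "('n::finite, 'e) pre_digraph"
  assumes "fin_digraph D" "loopfree_digraph D" "verts D = UNIV" "strongly_connected D"
    and gcd: "Gcd (range (num_converging_trees D)) = 1"
  shows "0 < num_converging_trees D j"
proof (rule ccontr)
  let ?c = "num_converging_trees D"
  interpret fin_digraph D by fact
  assume "\<not> 0 < ?c j"
  then have "?c j = 0" by simp
  have pred: "?c u = 0" if "u \<rightarrow>\<^bsub>D\<^esub> v" "?c v = 0" for u v
  proof -
    obtain e where e: "e \<in> arcs D" "tail D e = u" "head D e = v"
      using \<open>u \<rightarrow>\<^bsub>D\<^esub> v\<close> by (rule reachableE)
    let ?a = "\<lambda>i. card {e \<in> arcs D. tail D e = i \<and> head D e = v}"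
    have "0 = (\<Sum>i\<in>UNIV. real (?c i) * laplacian D $ i $ v)"
      using converging_trees_relation[OF assms(1-3)] by (auto simp: vec_eq_iff)
    also have "\<dots> = (\<Sum>i\<in>UNIV. - (real (?c i) * real (?a i)))"
      \<comment> \<open>The outdegree occurs only in the term \<open>i = v\<close>, which vanishes
        with \<open>?c v\<close>.\<close>
      by (intro sum.cong) (use \<open>?c v = 0\<close> in
          \<open>auto simp: laplacian_def outdegree_matrix_def adjacency_matrix_def\<close>)
    finally have "(\<Sum>i\<in>UNIV. real (?c i) * real (?a i)) = 0" by (simp add: sum_negf)
    then have "real (?c u) * real (?a u) = 0"
      by (subst (asm) sum_nonneg_eq_0_iff) auto
    moreover have "?a u \<noteq> 0"
      using e by (auto simp: card_eq_0_iff)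
    ultimately show ?thesis by simp
  qed
  \<comment> \<open>Strong connectivity carries the zero backwards from \<open>j\<close> to every
    vertex, against the gcd being 1.\<close>
  have "?c i = 0" for i
  proof -
    have "i \<rightarrow>\<^sup>*\<^bsub>D\<^esub> j"
      using assms by (auto simp: strongly_connected_def)
    then show ?thesis
      by (induction rule: converse_reachable_induct) (use \<open>?c j = 0\<close> pred in auto)
  qed
  then have "range ?c = {0}" by auto
  then show False using gcd by simp
qed

text \<open>If row \<open>i\<close> is \<open>k\<close> times a lattice point with coefficients
  \<open>a\<close>, then the unit vector at \<open>i\<close> minus \<open>k\<close> times
  \<open>a\<close> is a left kernel vector \<open>b\<close>, hence proportional to the tree counts.
  As \<open>k\<close> divides \<open>b j\<close> for \<open>j \<noteq> i\<close>, it divides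
  \<open>b i\<close> times each tree count away from \<open>i\<close>; these counts are coprime, so
  \<open>k\<close> divides \<open>b i = 1 - k * a i\<close>, and thus 1.\<close>

lemma primitive_laplacian_row:
  fixes D :: "('n::finite, 'e) pre_digraph"
  assumes "fin_digraph D" "loopfree_digraph D" "verts D = UNIV"
    and gen: "group_closure (range (\<lambda>i. laplacian D $ i)) = M"
    and wf: "well_formed_weights (num_converging_trees D)"
    and nonzero: "laplacian D $ i \<noteq> 0"
  shows "primitive_in M (laplacian D $ i)"
  unfolding primitive_in_def
proof (intro conjI ballI allI impI nonzero)
  let ?L = "laplacian D" and ?c = "num_converging_trees D"
  show "?L $ i \<in> M"
    unfolding gen[symmetric] by (rule group_closure.base) simp
  fix u k assume "u \<in> M" and u: "?L $ i = of_int k *\<^sub>R u"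
  then obtain a :: "'n \<Rightarrow> int" where a: "u = (\<Sum>j\<in>UNIV. of_int (a j) *\<^sub>R ?L $ j)"
    unfolding gen[symmetric] by (elim group_closure_rangeE)
  define b :: "'n \<Rightarrow> int" where "b j = (if j = i then 1 else 0) - k * a j" for j
  have "(\<Sum>j\<in>UNIV. of_int (b j) *\<^sub>R ?L $ j) =
      (\<Sum>j\<in>UNIV. (if j = i then ?L $ i else 0) - of_int k *\<^sub>R (of_int (a j) *\<^sub>R ?L $ j))"
    by (intro sum.cong) (auto simp: b_def scaleR_left_diff_distrib)
  also have "\<dots> = ?L $ i - of_int k *\<^sub>R u"
    by (simp add: sum_subtractf a scaleR_sum_right)
  finally have "(\<Sum>j\<in>UNIV. of_int (b j) *\<^sub>R ?L $ j) = 0" using u by simp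
  then have "real_of_int (b i) * real (?c j) = real_of_int (b j) * real (?c i)" for j
    using left_kernel_proportional_diag_cofactor[OF zero_row_sums_laplacian[OF assms(1)],
        of "\<lambda>j. of_int (b j)" i j]
    by (simp add: matrix_tree[OF assms(1-3)])
  then have cross: "b i * int (?c j) = b j * int (?c i)" for j
    by (metis of_int_eq_iff of_int_mult of_int_of_nat_eq)
  have "nat \<bar>k\<bar> dvd nat \<bar>b i\<bar> * ?c j" if "j \<noteq> i" for j
  proof -
    have "k dvd b i * int (?c j)"
      unfolding cross using that by (simp add: b_def)
    then have "\<bar>k\<bar> dvd \<bar>b i * int (?c j)\<bar>" by simp
    then have "int (nat \<bar>k\<bar>) dvd int (nat \<bar>b i\<bar> * ?c j)" by (simp add: abs_mult)
    then show ?thesis by (simp only: int_dvd_int_iff)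
  qed
  then have "nat \<bar>k\<bar> dvd Gcd ((*) (nat \<bar>b i\<bar>) ` ?c ` (UNIV - {i}))"
    by (intro Gcd_greatest) blast
  then have "nat \<bar>k\<bar> dvd nat \<bar>b i\<bar>"
    using wf by (simp add: Gcd_mult well_formed_weights_def)
  then have "k dvd b i" by (simp add: nat_dvd_iff)
  then have "k dvd b i + k * a i" by simp
  then have "k dvd 1" by (simp add: b_def)
  then show "\<bar>k\<bar> = 1" by simp
qed

theorem proposition8:
  fixes D :: "('n::finite, 'e) pre_digraph"
  assumes "fin_digraph D"
    and "loopfree_digraph D"
    and "verts D = UNIV"
    and "\<And>v. in_degree D v \<noteq> 0 \<or> out_degree D v \<noteq> 0"
    and "strongly_connected D"
    and "Gcd (range (num_converging_trees D)) = 1"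
  shows "equivalent_to_wps sum_zero_lattice (laplacian_polytope D) (num_converging_trees D)"
proof -
  let ?L = "laplacian D" and ?c = "num_converging_trees D"
  have gen: "group_closure (range (\<lambda>i. ?L $ i)) = sum_zero_lattice"
    using assms by (intro laplacian_rows_generate_sum_zero_lattice)
  \<comment> \<open>A zero row puts a unit vector into the left kernel, so all tree counts away from
    \<open>i\<close> vanish and their gcd is 0. For n = 1 the only row is zero, but the weight is
    not well-formed, since \<open>Gcd {} = 0\<close>.\<close>
  have "?L $ i \<noteq> 0" if "well_formed_weights ?c" for i
  proof
    assume "?L $ i = 0"
    then have "(\<Sum>j\<in>UNIV. of_bool (j = i) *\<^sub>R ?L $ j) = 0"
      by (simp add: if_distrib[of "\<lambda>c. c *\<^sub>R _"] of_bool_def cong: if_cong)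
    then have zero: "?c j = 0" if "j \<noteq> i" for j
      using left_kernel_proportional_diag_cofactor[OF zero_row_sums_laplacian[OF assms(1)], of _ i j]
        that by (fastforce simp: matrix_tree[OF assms(1-3)])
    have "Gcd (?c ` (UNIV - {i})) = 0"
      by (auto simp: Gcd_0_iff zero)
    moreover have "Gcd (?c ` (UNIV - {i})) = 1"
      using that unfolding well_formed_weights_def by blast
    ultimately show False by (simp only: zero_neq_one)
  qed
  then have "wps_vertices ?c sum_zero_lattice (\<lambda>i. ?L $ i)"
    unfolding wps_vertices_def
    using lattice_of_rank_sum_zero_lattice gen converging_trees_relation[OF assms(1-3)]
      primitive_laplacian_row[OF assms(1-3) gen] by blast
  moreover have "unimodularly_equivalent sum_zero_lattice (laplacian_polytope D) sum_zero_lattice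
      (convex hull (range (\<lambda>i. ?L $ i)))"
    unfolding unimodularly_equivalent_def laplacian_polytope_def row_def vec_lambda_eta
    by (intro exI[of _ id] exI[of _ 0]) (simp add: linear_id)
  ultimately show ?thesis
    unfolding equivalent_to_wps_def
    using num_converging_trees_pos[OF assms(1-3,5,6)] assms(6) by blast
qed

end
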